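(* Assume that $n(m) < \infty$ for every positive integer $m$. Let $N \geq 2$ be an integer and let $z_N \in \mathbb{C}$ be any root of the Collatz polynomial $P_N(z)$. Then $$\frac{2\, M(N)}{3\, M(N) + 1} \leq |z_N| \leq 2,$$ where $M(N)$ is the least odd Collatz iterate of $N$ that is greater than $1$ if such an iterate exists, and $M(N) := -1/2$ otherwise (in which case the left-hand side equals $2$).
   Context: For a non-negative integer $N$ define $c(N) = N/2$ if $N$ is even, $c(N) = (3N+1)/2$ if $N$ is odd and $N \neq 1$, and $c(1) = 0$. Put $c^0(N) = N$ and $c^j(N) = c(c^{j-1}(N))$ for $j \geq 1$; the numbers $c^j(N)$, $j \geq 0$, are the Collatz iterates of $N$ (so $N$ itself is an iterate). Let $n(N) = \min\{ j \geq 0 : c^j(N) = 1\}$ (with $n(N)=\infty$ if there is no such $j$). Standing assumption: $n(N) < \infty$ for all positive integers $N$. The $N$th Collatz polynomial is $P_N(z) = \sum_{j=0}^{n(N)} c^j(N)\, z^j$. *)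

theory Defs
  imports Complex_Main "HOL-Library.Extended_Nat" "HOL-Computational_Algebra.Polynomial"
begin

(* Both uses of div are exact. *)
definition collatz :: "nat \<Rightarrow> nat" where
  "collatz N = (if even N then N div 2 else if N \<noteq> 1 then (3 * N + 1) div 2 else 0)"

definition collatz_iterates :: "nat \<Rightarrow> nat set" where
  "collatz_iterates N = {(collatz ^^ j) N | j. True}"

(* The infimum of the empty set in enat is \<infinity>, the value for orbits that never reach 1. *)
definition collatz_time :: "nat \<Rightarrow> enat" where
  "collatz_time N = Inf {enat j | j. (collatz ^^ j) N = 1}"

(* Only meaningful when collatz_time N is finite. *)
definition collatz_poly :: "nat \<Rightarrow> complex poly" where
  "collatz_poly N = (\<Sum>j = 0..the_enat (collatz_time N). monom (of_nat ((collatz ^^ j) N)) j)"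

definition min_odd_iterate :: "nat \<Rightarrow> real" where
  "min_odd_iterate N =
    (if \<exists>m \<in> collatz_iterates N. odd m \<and> m > 1
     then real (LEAST m. m \<in> collatz_iterates N \<and> odd m \<and> m > 1)
     else - 1 / 2)"

end

theory Submission
  imports Defs
begin

text \<open>
  The theorem is the Enestrom--Kakeya bound: the roots of a polynomial with positive coefficients
  \<open>a\<^sub>0, \<dots>, a\<^sub>n\<close> lie in an annulus whose radii are the least and the greatest ratio
  \<open>a\<^sub>j / a\<^sub>j\<^sub>+\<^sub>1\<close> of neighbouring coefficients (lemmas \<open>Enestrom_Kakeya_lower\<close> and
  \<open>Enestrom_Kakeya_upper\<close>). The coefficients of a Collatz polynomial are the iterates up to the
  first \<open>1\<close>, so they are positive, and the ratio of an iterate to its successor is \<open>2\<close> if the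
  iterate is even and \<open>2 m / (3 m + 1)\<close> if it is an odd number \<open>m > 1\<close>. The latter is below \<open>2\<close>
  and increases with \<open>m\<close>; hence no ratio exceeds \<open>2\<close>, and none is below
  \<open>2 M / (3 M + 1)\<close> for the least such \<open>m\<close>, called \<open>M\<close>. If there is no such \<open>m\<close>, every ratio is \<open>2\<close>,
  which is also the value of \<open>2 M / (3 M + 1)\<close> at \<open>M = - 1 / 2\<close>.
\<close>

lemma linear_factor_times_power_sum:
  fixes r z :: "'a :: comm_ring_1" and a :: "nat \<Rightarrow> 'a"
  shows "(r - z) * (\<Sum>j\<le>n. a j * z ^ j) =
    r * a 0 - ((\<Sum>j<n. (a j - r * a (Suc j)) * z ^ Suc j) + a n * z ^ Suc n)"
  by (induction n) (simp_all add: algebra_simps)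

text \<open>
  Multiplying by \<open>r - z\<close> gives \<open>r a\<^sub>0\<close> minus a polynomial \<open>h\<close> with nonnegative coefficients. At a
  root, \<open>h z = r a\<^sub>0\<close>, and so \<open>r a\<^sub>0 \<le> h s\<close> with \<open>s = cmod z\<close>. If \<open>s < r\<close>, the same identity at the real point
  \<open>s\<close> makes \<open>r a\<^sub>0 - h s\<close> the product of \<open>r - s\<close> and a positive sum, a contradiction.
\<close>
lemma Enestrom_Kakeya_lower:
  fixes a :: "nat \<Rightarrow> real" and z :: complex
  assumes pos: "\<And>j. j \<le> n \<Longrightarrow> 0 < a j"
    and ratio: "\<And>j. j < n \<Longrightarrow> r * a (Suc j) \<le> a j"
    and root: "(\<Sum>j\<le>n. of_real (a j) * z ^ j) = 0"
  shows "r \<le> cmod z"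
proof (rule ccontr)
  assume "\<not> r \<le> cmod z"
  define s where "s = cmod z"
  have "s < r" "0 \<le> s" using \<open>\<not> r \<le> cmod z\<close> by (auto simp: s_def)
  define h where "h = (\<Sum>j<n. (a j - r * a (Suc j)) * s ^ Suc j) + a n * s ^ Suc n"
  have "of_real (r * a 0) =
      (\<Sum>j<n. of_real (a j - r * a (Suc j)) * z ^ Suc j) + of_real (a n) * z ^ Suc n"
    using linear_factor_times_power_sum[of "of_real r" z "\<lambda>j. of_real (a j)" n] root
    by simp
  hence "cmod (of_real (r * a 0)) =
      cmod ((\<Sum>j<n. of_real (a j - r * a (Suc j)) * z ^ Suc j) + of_real (a n) * z ^ Suc n)"
    by simp
  also have "\<dots> \<le> (\<Sum>j<n. cmod (of_real (a j - r * a (Suc j)) * z ^ Suc j))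
      + cmod (of_real (a n) * z ^ Suc n)"
    by (intro norm_triangle_le add_mono norm_sum order_refl)
  also have "\<dots> = h"
    unfolding h_def s_def norm_mult norm_power norm_of_real
    using pos[of n] ratio by (intro arg_cong2[where f = "(+)"] sum.cong) auto
  finally have "r * a 0 \<le> h" by (simp only: norm_of_real)
  moreover have "(r - s) * (\<Sum>j\<le>n. a j * s ^ j) = r * a 0 - h"
    unfolding h_def by (rule linear_factor_times_power_sum)
  moreover have "a 0 \<le> (\<Sum>j\<le>n. a j * s ^ j)"
    using member_le_sum[of 0 "{..n}" "\<lambda>j. a j * s ^ j"] pos \<open>0 \<le> s\<close>
    by (simp add: less_imp_le)
  ultimately show False
    using mult_pos_pos[of "r - s" "\<Sum>j\<le>n. a j * s ^ j"] pos[of 0] \<open>s < r\<close> by linarith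
qed

text \<open>
  This is the lower bound for the reciprocal polynomial: reversing the coefficients turns the root
  \<open>z\<close> into \<open>1 / z\<close> and inverts the ratios.
\<close>
lemma Enestrom_Kakeya_upper:
  fixes a :: "nat \<Rightarrow> real" and z :: complex
  assumes pos: "\<And>j. j \<le> n \<Longrightarrow> 0 < a j"
    and R: "0 < R"
    and ratio: "\<And>j. j < n \<Longrightarrow> a j \<le> R * a (Suc j)"
    and root: "(\<Sum>j\<le>n. of_real (a j) * z ^ j) = 0"
  shows "cmod z \<le> R"
proof (cases "z = 0")
  case True
  then show ?thesis using R by simp
next
  case False
  have "(\<Sum>j\<le>n. of_real (a j) * z ^ j) = (\<Sum>j\<le>n. of_real (a (n - j)) * z ^ (n - j))"
    using sum.nat_diff_reindex[of "\<lambda>j. of_real (a j) * z ^ j" "Suc n"]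
    by (simp add: lessThan_Suc_atMost)
  also have "\<dots> = z ^ n * (\<Sum>j\<le>n. of_real (a (n - j)) * inverse z ^ j)"
    unfolding sum_distrib_left using False
    by (intro sum.cong) (auto simp: power_diff field_simps)
  finally have "(\<Sum>j\<le>n. of_real (a (n - j)) * inverse z ^ j) = 0"
    using root False by simp
  moreover have "inverse R * a (n - Suc j) \<le> a (n - j)" if "j < n" for j
    using ratio[of "n - Suc j"] that R by (simp add: Suc_diff_Suc field_simps)
  ultimately have "inverse R \<le> cmod (inverse z)"
    using pos by (intro Enestrom_Kakeya_lower[of n "\<lambda>j. a (n - j)"]) auto
  then show ?thesis using R False by (simp add: norm_inverse)
qed

lemma collatz_time_finiteE:
  assumes "collatz_time N < \<infinity>"
  obtains n where "collatz_time N = enat n" "(collatz ^^ n) N = 1"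
    "\<And>j. j < n \<Longrightarrow> (collatz ^^ j) N \<noteq> 1"
proof -
  let ?n = "LEAST j. (collatz ^^ j) N = 1"
  have "\<exists>j. (collatz ^^ j) N = 1"
  proof (rule ccontr)
    assume "\<nexists>j. (collatz ^^ j) N = 1"
    then have "collatz_time N = Inf {}"
      unfolding collatz_time_def by (intro arg_cong[where f = Inf]) auto
    then show False using assms by (simp add: Inf_enat_def)
  qed
  then have one: "(collatz ^^ ?n) N = 1" by (rule LeastI_ex)
  have "collatz_time N = enat ?n"
    unfolding collatz_time_def
  proof (rule antisym)
    show "Inf {enat j | j. (collatz ^^ j) N = 1} \<le> enat ?n"
      using one by (intro Inf_lower) blast
    show "enat ?n \<le> Inf {enat j | j. (collatz ^^ j) N = 1}"
      by (intro Inf_greatest) (auto intro: Least_le)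
  qed
  then show ?thesis using that one not_less_Least by blast
qed

lemma collatz_pos: "2 \<le> m \<Longrightarrow> 0 < collatz m"
  by (auto simp: collatz_def)

lemma collatz_iterate_ge_2:
  assumes "2 \<le> N" and "\<And>i. i \<le> j \<Longrightarrow> (collatz ^^ i) N \<noteq> 1"
  shows "2 \<le> (collatz ^^ j) N"
  using assms(2)
proof (induction j)
  case 0
  then show ?case using assms(1) by simp
next
  case (Suc j)
  then have "0 < (collatz ^^ Suc j) N" by (simp add: collatz_pos)
  moreover have "(collatz ^^ Suc j) N \<noteq> 1" using Suc.prems by blast
  ultimately show ?case by linarith
qed

lemma collatz_even: "even m \<Longrightarrow> 2 * real (collatz m) = real m"
  by (auto simp: collatz_def elim!: evenE)

lemma collatz_odd: "odd m \<Longrightarrow> m \<noteq> 1 \<Longrightarrow> 2 * real (collatz m) = 3 * real m + 1"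
proof -
  assume "odd m" "m \<noteq> 1"
  then have "2 * collatz m = 3 * m + 1" by (simp add: collatz_def)
  then show ?thesis by (simp flip: of_nat_mult of_nat_add)
qed

lemma collatz_ratio_upper: "2 \<le> m \<Longrightarrow> real m \<le> 2 * real (collatz m)"
  using collatz_even[of m] collatz_odd[of m] by (cases "even m") auto

lemma odd_ratio_mono:
  fixes x y :: real
  assumes "0 \<le> x" "x \<le> y"
  shows "2 * x / (3 * x + 1) \<le> 2 * y / (3 * y + 1)"
  using assms by (simp add: field_simps)

lemma min_odd_iterate_bounds:
  assumes "m \<in> collatz_iterates N" "odd m" "1 < m"
  shows "0 \<le> min_odd_iterate N" "min_odd_iterate N \<le> real m"
  using assms by (auto simp: min_odd_iterate_def intro!: Least_le)

lemma min_odd_iterate_ratio_le_2: "2 * min_odd_iterate N / (3 * min_odd_iterate N + 1) \<le> 2"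
proof -
  have "0 \<le> min_odd_iterate N \<or> min_odd_iterate N = - 1 / 2"
    by (simp add: min_odd_iterate_def)
  then show ?thesis by (auto simp: field_simps)
qed

lemma collatz_ratio_lower:
  assumes "m \<in> collatz_iterates N" "2 \<le> m"
  shows "2 * min_odd_iterate N / (3 * min_odd_iterate N + 1) * real (collatz m) \<le> real m"
    (is "?r * _ \<le> _")
proof (cases "even m")
  case True
  have "?r * real (collatz m) \<le> 2 * real (collatz m)"
    by (intro mult_right_mono min_odd_iterate_ratio_le_2) simp
  then show ?thesis using collatz_even[OF True] by simp
next
  case False
  have "?r \<le> 2 * real m / (3 * real m + 1)"
    using min_odd_iterate_bounds[of m N] assms False by (intro odd_ratio_mono) auto
  then have "?r * real (collatz m) \<le> 2 * real m / (3 * real m + 1) * real (collatz m)"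
    by (intro mult_right_mono) auto
  also have "\<dots> = real m * (2 * real (collatz m) / (3 * real m + 1))" by simp
  also have "\<dots> = real m"
    using collatz_odd[OF False] assms by (simp add: add_nonneg_eq_0_iff)
  finally show ?thesis .
qed

theorem theorem1:
  fixes N :: nat and z :: complex
  assumes "\<And>m :: nat. m > 0 \<Longrightarrow> collatz_time m < \<infinity>"
    and "N \<ge> 2"
    and "poly (collatz_poly N) z = 0"
  shows "2 * min_odd_iterate N / (3 * min_odd_iterate N + 1) \<le> cmod z \<and> cmod z \<le> 2"
proof -
  obtain n where n: "collatz_time N = enat n" "(collatz ^^ n) N = 1"
    "\<And>j. j < n \<Longrightarrow> (collatz ^^ j) N \<noteq> 1"
    using collatz_time_finiteE assms(1)[of N] assms(2) by auto
  define a where "a j = real ((collatz ^^ j) N)" for j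
  have ge_2: "2 \<le> (collatz ^^ j) N" if "j < n" for j
    using that n(3) assms(2) by (intro collatz_iterate_ge_2) auto
  have pos: "0 < a j" if "j \<le> n" for j
    using that ge_2[of j] n(2) by (cases "j = n") (auto simp: a_def)
  have iterate: "(collatz ^^ j) N \<in> collatz_iterates N" for j
    by (auto simp: collatz_iterates_def)
  have root: "(\<Sum>j\<le>n. of_real (a j) * z ^ j) = 0"
    using assms(3) n(1)
    by (simp add: collatz_poly_def poly_sum poly_monom a_def atLeast0AtMost)
  have "2 * min_odd_iterate N / (3 * min_odd_iterate N + 1) \<le> cmod z"
  proof (rule Enestrom_Kakeya_lower[OF pos _ root])
    fix j assume "j < n"
    then show "2 * min_odd_iterate N / (3 * min_odd_iterate N + 1) * a (Suc j) \<le> a j"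
      using collatz_ratio_lower[OF iterate ge_2] by (simp add: a_def)
  qed
  moreover have "cmod z \<le> 2"
  proof (rule Enestrom_Kakeya_upper[OF pos _ _ root])
    fix j assume "j < n"
    then show "a j \<le> 2 * a (Suc j)"
      using collatz_ratio_upper[OF ge_2] by (simp add: a_def)
  qed simp_all
  ultimately show ?thesis by blast
qed

end
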